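(* Let $\mathbf{n}=(n_1,\ldots,n_d)\in\mathbb{N}^d$ have pairwise relatively prime entries. For $h\in\mathcal{L}(I^{(\mathbf{n})})$, the interpolation problem $$P(\mathbf{z}^{(\mathbf{n})}_{\mathbf{i}})=h(\mathbf{i})\quad\text{for all }\mathbf{i}\in I^{(\mathbf{n})}$$ has in the polynomial space $\Pi^{(\mathbf{n})}$ the uniquely determined solution $$P^{(\mathbf{n})}_h=\sum_{\mathbf{i}\in I^{(\mathbf{n})}}h(\mathbf{i})\,L^{(\mathbf{n})}_{\mathbf{i}}.$$ Further, $\operatorname{span}\{P^{(\mathbf{n})}_h\mid h\in\mathcal{L}(I^{(\mathbf{n})})\}=\Pi^{(\mathbf{n})}$ and the polynomials $L^{(\mathbf{n})}_{\mathbf{i}}$, $\mathbf{i}\in I^{(\mathbf{n})}$, form a basis of $\Pi^{(\mathbf{n})}$.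
   Context: $\mathbb{N}=\{1,2,\ldots\}$, $\mathbb{N}_0=\mathbb{N}\cup\{0\}$, $d\in\mathbb{N}$, $p[\mathbf{n}]=\prod_{j=1}^dn_j$. For $\mathfrak{r}\in\{0,1\}$ let $I^{(\mathbf{n})}_{\mathfrak{r}}$ be the set of all $\mathbf{i}\in\mathbb{N}_0^d$ with $0\le i_j\le n_j$ and $i_j\equiv\mathfrak{r}\bmod 2$ for all $j$, and $I^{(\mathbf{n})}=I^{(\mathbf{n})}_0\cup I^{(\mathbf{n})}_1$. $\mathcal{L}(I^{(\mathbf{n})})$ is the vector space of all functions $I^{(\mathbf{n})}\to\mathbb{C}$. The nodes are $\mathbf{z}^{(\mathbf{n})}_{\mathbf{i}}=(z^{(n_1)}_{i_1},\ldots,z^{(n_d)}_{i_d})$ with $z^{(m)}_i=\cos(i\pi/m)$. For $\mathbf{i}\in I^{(\mathbf{n})}$ put $\mathfrak{w}^{(\mathbf{n})}_{\mathbf{i}}=2^{\#M}/(2p[\mathbf{n}])$, where $M=\{j\mid 0<i_j<n_j\}$. $\Gamma^{(\mathbf{n})}$ is the union of $\{(0,\ldots,0,n_d)\}$ and the set of all $\boldsymbol{\gamma}\in\mathbb{N}_0^d$ such that $\gamma_i<n_i$ for all $i$ and $\gamma_i/n_i+\gamma_j/n_j<1$ for all $i\neq j$. With $T_\gamma(x)=\cos(\gamma\arccos x)$ the univariate Chebyshev polynomials, $T_{\boldsymbol{\gamma}}(\mathbf{x})=T_{\gamma_1}(x_1)\cdots T_{\gamma_d}(x_d)$ for $\mathbf{x}\in[-1,1]^d$,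 and $\Pi^{(\mathbf{n})}$ is the complex linear span of $\{T_{\boldsymbol{\gamma}}\mid\boldsymbol{\gamma}\in\Gamma^{(\mathbf{n})}\}$. The norm is the one of the inner product $\langle f,g\rangle=\frac{1}{\pi^d}\int_{[-1,1]^d}f(\mathbf{x})\overline{g(\mathbf{x})}\prod_{i=1}^d\frac{1}{\sqrt{1-x_i^2}}\,d\mathbf{x}$, so that $\|T_{\boldsymbol{\gamma}}\|^2=2^{-\mathfrak{e}(\boldsymbol{\gamma})}$ with $\mathfrak{e}(\boldsymbol{\gamma})=\#\{i\mid\gamma_i>0\}$. Put $K^{(\mathbf{n})}(\mathbf{x},\mathbf{x}')=\sum_{\boldsymbol{\gamma}\in\Gamma^{(\mathbf{n})}}\frac{1}{\|T_{\boldsymbol{\gamma}}\|^2}T_{\boldsymbol{\gamma}}(\mathbf{x})T_{\boldsymbol{\gamma}}(\mathbf{x}')$ and, for $\mathbf{i}\in I^{(\mathbf{n})}$, $$L^{(\mathbf{n})}_{\mathbf{i}}(\mathbf{x})=\mathfrak{w}^{(\mathbf{n})}_{\mathbf{i}}\Bigl(K^{(\mathbf{n})}(\mathbf{x},\mathbf{z}^{(\mathbf{n})}_{\mathbf{i}})-T_{n_d}(x_d)\,T_{n_d}(z^{(n_d)}_{i_d})\Bigr),\quad\mathbf{x}\in[-1,1]^d.$$ *)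

theory Defs
  imports "HOL-Analysis.Analysis" "HOL-Library.Function_Algebras" "HOL-Number_Theory.Cong"
begin

text \<open>
  The index set of the coordinates is a type \<open>'d\<close> of sort \<open>{finite, linorder}\<close>, playing the role
  of \<open>{1, \<dots>, d}\<close> with \<open>d = CARD('d)\<close>; \<open>last_index\<close> is then the index \<open>d\<close>.
  A function on the cube \<open>[-1,1]\<^sup>d\<close> is represented by its extension by \<open>0\<close> to \<open>real ^ 'd\<close>, so
  that equality on the type is equality on the cube.
\<close>

subsection \<open>The complex vector space of complex-valued functions\<close>

definition cfun_scale :: "complex \<Rightarrow> ('a \<Rightarrow> complex) \<Rightarrow> ('a \<Rightarrow> complex)" where
  "cfun_scale c f = (\<lambda>x. c * f x)"

global_interpretation cfun: vector_space cfun_scale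
  by unfold_locales (auto simp: cfun_scale_def fun_eq_iff algebra_simps)

subsection \<open>Index sets, nodes and weights\<close>

definition last_index :: "'d::{finite,linorder}" where
  "last_index = Max UNIV"

definition index_set_par :: "nat \<Rightarrow> nat ^ 'd \<Rightarrow> (nat ^ 'd) set" where
  "index_set_par r n = {i. \<forall>j. i $ j \<le> n $ j \<and> [i $ j = r] (mod 2)}"

definition index_set :: "nat ^ 'd \<Rightarrow> (nat ^ 'd) set" where
  "index_set n = index_set_par 0 n \<union> index_set_par 1 n"

definition data_space :: "nat ^ 'd \<Rightarrow> (nat ^ 'd \<Rightarrow> complex) set" where
  "data_space n = index_set n \<rightarrow>\<^sub>E UNIV"

definition cheb_point :: "nat \<Rightarrow> nat \<Rightarrow> real" where
  "cheb_point m i = cos (real i * pi / real m)"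

definition node :: "nat ^ 'd \<Rightarrow> nat ^ 'd \<Rightarrow> real ^ 'd" where
  "node n i = (\<chi> j. cheb_point (n $ j) (i $ j))"

definition weight :: "nat ^ 'd \<Rightarrow> nat ^ 'd \<Rightarrow> real" where
  "weight n i = 2 ^ card {j. 0 < i $ j \<and> i $ j < n $ j} / (2 * real (\<Prod>j\<in>UNIV. n $ j))"

subsection \<open>The polynomial space\<close>

definition spectral_set :: "nat ^ 'd::{finite,linorder} \<Rightarrow> (nat ^ 'd::{finite,linorder}) set" where
  "spectral_set n =
     {\<chi> j. if j = last_index then n $ j else 0} \<union>
     {\<gamma>. (\<forall>i. \<gamma> $ i < n $ i) \<and>
          (\<forall>i j. i \<noteq> j \<longrightarrow> real (\<gamma> $ i) / real (n $ i) + real (\<gamma> $ j) / real (n $ j) < 1)}"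

definition cube :: "(real ^ 'd) set" where
  "cube = {x. \<forall>j. -1 \<le> x $ j \<and> x $ j \<le> 1}"

text \<open>Only meaningful for \<open>x\<close> in \<open>[-1,1]\<close>, where \<open>arccos\<close> is specified.\<close>

definition cheb1 :: "nat \<Rightarrow> real \<Rightarrow> real" where
  "cheb1 k x = cos (real k * arccos x)"

definition cheb :: "nat ^ 'd \<Rightarrow> real ^ 'd \<Rightarrow> complex" where
  "cheb \<gamma> x = (if x \<in> cube then of_real (\<Prod>j\<in>UNIV. cheb1 (\<gamma> $ j) (x $ j)) else 0)"

definition poly_space ::
  "nat ^ 'd::{finite,linorder} \<Rightarrow> (real ^ 'd::{finite,linorder} \<Rightarrow> complex) set" where
  "poly_space n = cfun.span (cheb ` spectral_set n)"

definition cheb_inner :: "(real ^ 'd \<Rightarrow> complex) \<Rightarrow> (real ^ 'd \<Rightarrow> complex) \<Rightarrow> complex" where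
  "cheb_inner f g =
     of_real (1 / pi ^ CARD('d)) *
     (LINT x:cube|lborel. f x * cnj (g x) * of_real (\<Prod>j\<in>UNIV. 1 / sqrt (1 - (x $ j)\<^sup>2)))"

definition cheb_norm :: "(real ^ 'd \<Rightarrow> complex) \<Rightarrow> real" where
  "cheb_norm f = sqrt (Re (cheb_inner f f))"

subsection \<open>The interpolating polynomials\<close>

definition kernel ::
  "nat ^ 'd::{finite,linorder} \<Rightarrow>
   real ^ 'd::{finite,linorder} \<Rightarrow> real ^ 'd::{finite,linorder} \<Rightarrow> complex" where
  "kernel n x x' =
     (\<Sum>\<gamma>\<in>spectral_set n. of_real (1 / (cheb_norm (cheb \<gamma>))\<^sup>2) * cheb \<gamma> x * cheb \<gamma> x')"

definition lagrange ::
  "nat ^ 'd::{finite,linorder} \<Rightarrow> nat ^ 'd::{finite,linorder} \<Rightarrow>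
   real ^ 'd::{finite,linorder} \<Rightarrow> complex" where
  "lagrange n i x =
     (if x \<in> cube then
        of_real (weight n i) *
        (kernel n x (node n i) -
         of_real (cheb1 (n $ last_index) (x $ last_index) *
                  cheb1 (n $ last_index) (cheb_point (n $ last_index) (i $ last_index))))
      else 0)"

definition interp ::
  "nat ^ 'd::{finite,linorder} \<Rightarrow> (nat ^ 'd::{finite,linorder} \<Rightarrow> complex) \<Rightarrow>
   real ^ 'd::{finite,linorder} \<Rightarrow> complex" where
  "interp n h = (\<Sum>i\<in>index_set n. cfun_scale (h i) (lagrange n i))"

definition solves :: "nat ^ 'd \<Rightarrow> (nat ^ 'd \<Rightarrow> complex) \<Rightarrow> (real ^ 'd \<Rightarrow> complex) \<Rightarrow> bool" where
  "solves n h P \<longleftrightarrow> (\<forall>i\<in>index_set n. P (node n i) = h i)"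

end

theory Submission
  imports Defs
begin

text \<open>
  Only products of cosines matter: at the node with index \<open>i\<close> the polynomial \<open>T\<^sub>\<gamma>\<close> takes the value
  \<open>\<Prod>\<^sub>j cos (\<gamma>\<^sub>j i\<^sub>j \<pi> / n\<^sub>j)\<close>. The weighted sum over the nodes splits into the two parity classes, on each of
  which it factorizes; this makes the \<open>T\<^sub>\<gamma>\<close> with \<open>\<gamma>\<close> in the spectral set discretely orthogonal, and
  hence \<open>\<Sum>\<^sub>i P(z\<^sub>i) L\<^sub>i = P\<close> for every \<open>P\<close> in the polynomial space. For the converse
  \<open>L\<^sub>i(z\<^sub>k) = \<delta>\<^sub>i\<^sub>k\<close> no cardinality count is needed: the cosine products with \<open>0 \<le> \<gamma>\<^sub>j \<le> n\<^sub>j\<close> span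
  all functions on the full grid, and since all entries of an index have the same parity,
  replacing \<open>\<gamma>\<^sub>j\<close> by \<open>n\<^sub>j - \<gamma>\<^sub>j\<close> in two coordinates at once does not change the
  values at the nodes. Such replacements bring every \<open>\<gamma>\<close> into the spectral set, where coprimality
  excludes \<open>\<gamma>\<^sub>i / n\<^sub>i + \<gamma>\<^sub>j / n\<^sub>j = 1\<close> except for \<open>\<gamma>\<close> equivalent to \<open>(0, \<dots>, 0, n\<^sub>d)\<close>.
\<close>

subsection \<open>One-dimensional cosine sums\<close>

text \<open>Trapezoidal weights, doubled. The 2 at inner points is what one coordinate contributes
  to the power of 2 in \<open>weight\<close>.\<close>

definition end_weight :: "nat \<Rightarrow> nat \<Rightarrow> real" where
  "end_weight m i = (if 0 < i \<and> i < m then 2 else 1)"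

text \<open>For \<open>1 \<le> m\<close> and \<open>i \<le> m\<close> this is
  \<open>cheb1 g (cheb_point m i)\<close>. Written without \<open>arccos\<close> it is symmetric in
  frequency and position.\<close>

definition cos_grid :: "nat \<Rightarrow> nat \<Rightarrow> nat \<Rightarrow> real" where
  "cos_grid m g i = cos (real g * real i * pi / real m)"

text \<open>Each inner point belongs to two of the intervals \<open>[i, i + 1]\<close>, each end
  point to one.\<close>

lemma sum_end_weight:
  assumes "m \<ge> 1"
  shows "(\<Sum>i\<le>m. end_weight m i * f i) = (\<Sum>i<m. f i + f (Suc i))"
proof -
  have "(\<Sum>i\<le>m. end_weight m i * f i) =
      (\<Sum>i\<le>m. (if i = m then 0 else f i) + (if i = 0 then 0 else f i))"
    using assms by (intro sum.cong) (auto simp: end_weight_def)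
  also have "\<dots> = (\<Sum>i\<le>m. if i = m then 0 else f i) + (\<Sum>i\<le>m. if i = 0 then 0 else f i)"
    by (rule sum.distrib)
  also have "(\<Sum>i\<le>m. if i = m then 0 else f i) = (\<Sum>i<m. f i)"
    by (rule sum.mono_neutral_cong_right) auto
  also have "(\<Sum>i\<le>m. if i = 0 then 0 else f i) = (\<Sum>i<m. f (Suc i))"
    by (simp add: sum.atMost_shift)
  finally show ?thesis by (simp add: sum.distrib)
qed

lemma sum_end_weight_cos:
  assumes "m \<ge> 1"
  shows "(\<Sum>i\<le>m. end_weight m i * cos_grid m g i) = (if 2 * m dvd g then 2 * real m else 0)"
proof (cases "2 * m dvd g")
  case True
  then obtain q where q: "g = 2 * m * q" by (auto simp: dvd_def)
  have "cos_grid m g i = 1" for i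
  proof -
    have "real g * real i * pi / real m = 2 * pi * real (q * i)"
      using assms q by (simp add: field_simps)
    then show ?thesis
      unfolding cos_grid_def using cos_int_2pin[of "int (q * i)"] by simp
  qed
  then show ?thesis using assms True sum_end_weight[of m "\<lambda>_. 1"] by simp
next
  case False
  define \<theta> where "\<theta> = real g * pi / real m"
  have cg: "cos_grid m g i = cos (real i * \<theta>)" for i
    by (simp add: cos_grid_def \<theta>_def mult_ac)
  \<comment> \<open>the summands are \<open>2 cos((i + 1/2)\<theta>) cos(\<theta>/2)\<close>, and multiplying by \<open>sin(\<theta>/2)\<close> makes them telescope\<close>
  have tele: "sin (\<theta>/2) * (cos (real i * \<theta>) + cos (real (Suc i) * \<theta>)) =
      cos (\<theta>/2) * (sin (real (Suc i) * \<theta>) - sin (real i * \<theta>))" for i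
  proof -
    define a where "a = real i * \<theta> + \<theta>/2"
    have "real i * \<theta> = a - \<theta>/2" "real (Suc i) * \<theta> = a + \<theta>/2"
      by (simp_all add: a_def algebra_simps)
    then show ?thesis by (simp add: sin_add cos_add sin_diff cos_diff)
  qed
  have "sin (\<theta>/2) * (\<Sum>i\<le>m. end_weight m i * cos_grid m g i) =
      (\<Sum>i<m. sin (\<theta>/2) * (cos (real i * \<theta>) + cos (real (Suc i) * \<theta>)))"
    using sum_end_weight[OF assms] by (simp add: cg sum_distrib_left)
  also have "\<dots> = cos (\<theta>/2) * (\<Sum>i<m. sin (real (Suc i) * \<theta>) - sin (real i * \<theta>))"
    unfolding tele by (simp add: sum_distrib_left)
  also have "\<dots> = cos (\<theta>/2) * sin (real m * \<theta>)"
    using sum_lessThan_telescope[of "\<lambda>i. sin (real i * \<theta>)" m] by simp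
  also have "real m * \<theta> = real g * pi"
    using assms by (simp add: \<theta>_def)
  finally have prod0: "sin (\<theta>/2) * (\<Sum>i\<le>m. end_weight m i * cos_grid m g i) = 0"
    by (simp add: sin_npi)
  have "sin (\<theta>/2) \<noteq> 0"
  proof
    assume "sin (\<theta>/2) = 0"
    then obtain k :: int where "\<theta>/2 = of_int k * pi"
      by (auto simp: sin_zero_iff_int2)
    then have "real g = real_of_int (2 * int m * k)"
      using assms by (simp add: \<theta>_def field_simps)
    then have "int g = 2 * int m * k" by linarith
    then have "int (2 * m) dvd int g" by simp
    then show False using False by (simp only: of_nat_dvd_iff)
  qed
  with prod0 False show ?thesis by simp
qed

text \<open>Product-to-sum formula; the conditional expresses \<open>|g - h|\<close>, since
  subtraction on \<open>nat\<close> truncates.\<close>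

lemma cos_grid_mult:
  "cos_grid m g i * cos_grid m h i =
    (cos_grid m (g + h) i + cos_grid m (if h \<le> g then g - h else h - g) i) / 2"
proof -
  have "cos_grid m (if h \<le> g then g - h else h - g) i =
      cos (real g * real i * pi / real m - real h * real i * pi / real m)"
  proof (cases "h \<le> g")
    case False
    have "cos (real g * real i * pi / real m - real h * real i * pi / real m) =
      cos (- (real g * real i * pi / real m - real h * real i * pi / real m))"
      by (rule cos_minus[symmetric])
    also have "\<dots> = cos (real (h - g) * real i * pi / real m)"
      using False by (intro arg_cong[where f = cos]) (simp add: of_nat_diff algebra_simps diff_divide_distrib)
    finally show ?thesis using False by (simp add: cos_grid_def)
  qed (simp add: cos_grid_def of_nat_diff algebra_simps diff_divide_distrib)
  moreover have "cos_grid m (g + h) i =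
      cos (real g * real i * pi / real m + real h * real i * pi / real m)"
    by (simp add: cos_grid_def algebra_simps add_divide_distrib)
  ultimately show ?thesis
    by (simp add: cos_grid_def cos_add cos_diff)
qed

text \<open>The shift adds \<open>i * pi\<close> to the angle. Read backwards, a sign detecting the
  parity of \<open>i\<close> is absorbed into the frequency, so sums over a parity class become sums
  over the whole grid.\<close>

lemma cos_grid_add_period:
  assumes "m \<ge> 1"
  shows "cos_grid m (g + m) i = (-1) ^ i * cos_grid m g i"
proof -
  have "real (g + m) * real i * pi / real m = real g * real i * pi / real m + real i * pi"
    using assms by (simp add: field_simps)
  then show ?thesis by (simp add: cos_grid_def cos_add sin_npi cos_npi)
qed

text \<open>The sign depends only on the parity of \<open>i\<close>, so it cancels when two
  coordinates of equal parity are reflected together.\<close>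

lemma cos_grid_reflect:
  assumes "m \<ge> 1" "g \<le> m"
  shows "cos_grid m (m - g) i = (-1) ^ i * cos_grid m g i"
proof -
  have "real (m - g) * real i * pi / real m = real i * pi - real g * real i * pi / real m"
    using assms by (simp add: field_simps of_nat_diff)
  then show ?thesis by (simp add: cos_grid_def cos_diff sin_npi cos_npi)
qed

lemma cos_grid_commute: "cos_grid m g i = cos_grid m i g"
  by (simp add: cos_grid_def mult_ac)

section \<open>Weighted means over one parity class of the grid\<close>

definition par_inner :: "nat \<Rightarrow> nat \<Rightarrow> (nat \<Rightarrow> real) \<Rightarrow> real" where
  "par_inner r m f = (\<Sum>i | i \<le> m \<and> [i = r] (mod 2). end_weight m i * f i) / real m"

text \<open>The factor \<open>(1 + (-1) ^ r * (-1) ^ i) / 2\<close> is the indicator of the parity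
  class of \<open>r\<close>.\<close>

lemma par_inner_eq:
  assumes "r \<in> {0, 1}"
  shows "par_inner r m f = (\<Sum>i\<le>m. end_weight m i * (f i + (-1) ^ r * ((-1) ^ i * f i))) / (2 * real m)"
proof -
  have "(\<Sum>i | i \<le> m \<and> [i = r] (mod 2). end_weight m i * f i) =
      (\<Sum>i\<le>m. end_weight m i * (f i + (-1) ^ r * ((-1) ^ i * f i)) / 2)"
  proof (rule sum.mono_neutral_cong_left)
    show "\<forall>i\<in>{..m} - {i. i \<le> m \<and> [i = r] (mod 2)}.
        end_weight m i * (f i + (-1) ^ r * ((-1) ^ i * f i)) / 2 = 0"
    proof
      fix i assume "i \<in> {..m} - {i. i \<le> m \<and> [i = r] (mod 2)}"
      then have "odd (i + r)" using assms by (auto simp: cong_def odd_iff_mod_2_eq_one)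
      then have "(-1) ^ r * (-1) ^ i = (-1 :: real)" 
        by (metis add.commute power_add neg_one_odd_power)
      then have "(-1) ^ r * ((-1) ^ i * f i) = - f i"
        by (metis mult.assoc mult_minus1)
      then show "end_weight m i * (f i + (-1) ^ r * ((-1) ^ i * f i)) / 2 = 0" by simp
    qed
    fix i assume "i \<in> {i. i \<le> m \<and> [i = r] (mod 2)}"
    then have "even (i + r)" using assms by (auto simp: cong_def odd_iff_mod_2_eq_one)
    then have "(-1) ^ r * (-1) ^ i = (1 :: real)" 
      by (metis add.commute power_add neg_one_even_power)
    then have "(-1) ^ r * ((-1) ^ i * f i) = f i"
      by (metis mult.assoc mult_1)
    then show "end_weight m i * f i = end_weight m i * (f i + (-1) ^ r * ((-1) ^ i * f i)) / 2" by simp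
  qed auto
  then show ?thesis by (simp add: par_inner_def sum_divide_distrib)
qed

text \<open>Product-to-sum and the frequency shift leave the frequencies \<open>g + h\<close>,
  \<open>|g - h|\<close> and both of these plus \<open>m\<close>; only multiples of
  \<open>2 * m\<close> survive. The case \<open>g + h = m\<close> is aliasing, with a sign that
  depends on the class.\<close>

lemma par_inner_cos_grid:
  assumes "m \<ge> 1" "g < m" "h < m" "r \<in> {0, 1}"
  shows "par_inner r m (\<lambda>i. cos_grid m g i * cos_grid m h i) =
    (of_bool (g = 0 \<and> h = 0) + of_bool (g = h) + (-1) ^ r * of_bool (g + h = m)) / 2"
proof -
  define a where "a = (if h \<le> g then g - h else h - g)"
  define E where "E k = (\<Sum>i\<le>m. end_weight m i * cos_grid m k i)" for k
  have "end_weight m i * (cos_grid m g i * cos_grid m h i + (-1) ^ r * ((-1) ^ i * (cos_grid m g i * cos_grid m h i)))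
     = (end_weight m i * cos_grid m (g + h) i + end_weight m i * cos_grid m a i
       + (-1) ^ r * (end_weight m i * cos_grid m (g + h + m) i + end_weight m i * cos_grid m (a + m) i)) / 2" for i
    unfolding cos_grid_mult cos_grid_add_period[OF assms(1)] a_def[symmetric]
    by (simp add: field_simps)
  then have "par_inner r m (\<lambda>i. cos_grid m g i * cos_grid m h i) =
      (E (g + h) + E a + (-1) ^ r * (E (g + h + m) + E (a + m))) / (4 * real m)"
    unfolding par_inner_eq[OF assms(4)] E_def
    by (simp only: sum.distrib sum_distrib_left[symmetric] sum_divide_distrib[symmetric])
  moreover have "2 * m dvd g + h \<longleftrightarrow> g = 0 \<and> h = 0"
    using assms by (auto dest: dvd_imp_le)
  moreover have "2 * m dvd a \<longleftrightarrow> g = h"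
    using assms by (auto simp: a_def dest: dvd_imp_le)
  \<comment> \<open>Since \<open>m \<le> g + h + m < 3 * m\<close>, the only possible multiple is
    \<open>2 * m\<close> itself.\<close>
  moreover have "2 * m dvd g + h + m \<longleftrightarrow> g + h = m"
  proof
    assume "2 * m dvd g + h + m"
    then obtain q where q: "g + h + m = 2 * m * q" by (auto simp: dvd_def)
    have "q \<noteq> 0" using q assms by (intro notI) simp
    moreover have "q < 2" 
    proof (rule ccontr)
      assume "\<not> q < 2"
      then have "2 * m * 2 \<le> 2 * m * q" by (intro mult_le_mono) auto
      with q assms show False by linarith
    qed
    ultimately have "q = 1" by linarith
    with q show "g + h = m" by simp
  qed (simp add: mult_2)
  moreover have "\<not> 2 * m dvd a + m"
    using assms by (auto simp: a_def dest: dvd_imp_le)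
  ultimately show ?thesis
    using assms(1) by (simp add: E_def sum_end_weight_cos) (simp add: field_simps)
qed

text \<open>Orthogonality with position and frequency exchanged; it inverts the cosine transform on
  all \<open>m + 1\<close> grid points.\<close>

lemma sum_end_weight_delta:
  assumes "m \<ge> 1" "k \<le> m" "i \<le> m"
  shows "end_weight m k / (2 * real m) * (\<Sum>g\<le>m. end_weight m g * (cos_grid m g k * cos_grid m g i)) = of_bool (i = k)"
proof -
  define a where "a = (if i \<le> k then k - i else i - k)"
  have "(\<Sum>g\<le>m. end_weight m g * (cos_grid m g k * cos_grid m g i)) =
      (\<Sum>g\<le>m. (end_weight m g * cos_grid m (k + i) g + end_weight m g * cos_grid m a g) / 2)"
    unfolding cos_grid_commute[of m _ k] cos_grid_commute[of m _ i] cos_grid_mult a_def[symmetric]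
    by (simp add: algebra_simps)
  also have "\<dots> = ((\<Sum>g\<le>m. end_weight m g * cos_grid m (k + i) g) + (\<Sum>g\<le>m. end_weight m g * cos_grid m a g)) / 2"
    by (simp add: sum.distrib sum_divide_distrib[symmetric])
  also have "\<dots> = ((if 2 * m dvd k + i then 2 * real m else 0) + (if 2 * m dvd a then 2 * real m else 0)) / 2"
    using assms by (simp only: sum_end_weight_cos)
  also have "2 * m dvd a \<longleftrightarrow> i = k"
    using assms by (auto simp: a_def dest: dvd_imp_le)
  \<comment> \<open>As \<open>k + i \<le> 2 * m\<close>, both must sit at the same end. The sum then
    doubles, which offsets the weight 1 instead of 2 in front.\<close>
  also have "2 * m dvd k + i \<longleftrightarrow> i = k \<and> (k = 0 \<or> k = m)"
    using assms by (auto simp: mult_2[symmetric] dest: dvd_imp_le)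
  finally show ?thesis
    using assms by (auto simp: end_weight_def)
qed

subsection \<open>Discrete orthogonality\<close>

lemma bij_betw_vec_nth_PiE:
  "bij_betw vec_nth {x :: 'b ^ 'd. \<forall>j. x $ j \<in> B j} (PiE UNIV B)"
  by (rule bij_betwI[where g = vec_lambda]) (auto simp: PiE_iff)

text \<open>Vectors are exchanged for functions so that \<open>prod_sum_PiE\<close> applies.
  Multivariate sums split into one-dimensional ones through this.\<close>

lemma sum_prod_vec:
  fixes f :: "'d::finite \<Rightarrow> 'b \<Rightarrow> 'c::comm_semiring_1"
  assumes "\<And>j. finite (B j)"
  shows "(\<Sum>x | \<forall>j. x $ j \<in> B j. \<Prod>j\<in>UNIV. f j (x $ j)) = (\<Prod>j\<in>UNIV. \<Sum>y\<in>B j. f j y)"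
  using assms
  by (subst prod_sum_PiE) (auto intro!: sum.reindex_bij_betw[OF bij_betw_vec_nth_PiE])

lemma finite_vec_box:
  fixes B :: "'d::finite \<Rightarrow> 'b set"
  assumes "\<And>j. finite (B j)"
  shows "finite {x. \<forall>j. x $ j \<in> B j}"
  by (subst bij_betw_finite[OF bij_betw_vec_nth_PiE]) (intro finite_PiE finite assms)

definition box_set :: "nat ^ 'd \<Rightarrow> (nat ^ 'd) set" where
  "box_set n = {i. \<forall>j. i $ j \<le> n $ j}"

lemma finite_box_set: "finite (box_set n)"
  using finite_vec_box[of "\<lambda>j. {..n $ j}"] by (simp add: box_set_def)

lemma index_set_subset_box: "index_set n \<subseteq> box_set n"
  by (auto simp: index_set_def index_set_par_def box_set_def)

lemma finite_index_set: "finite (index_set n)"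
  using finite_subset[OF index_set_subset_box finite_box_set] .

text \<open>The value of \<open>T_\<gamma>\<close> at the node of index \<open>i\<close>;
  \<open>cheb_node\<close> makes the connection.\<close>

definition grid_cheb :: "nat ^ 'd \<Rightarrow> nat ^ 'd \<Rightarrow> nat ^ 'd \<Rightarrow> real" where
  "grid_cheb n \<gamma> i = (\<Prod>j\<in>UNIV. cos_grid (n $ j) (\<gamma> $ j) (i $ j))"

text \<open>The weight is a tensor product up to the factor 1/2, which later averages the two parity
  classes.\<close>

lemma weight_eq:
  assumes "\<And>j. 1 \<le> n $ j"
  shows "weight n i = (\<Prod>j\<in>UNIV. end_weight (n $ j) (i $ j) / real (n $ j)) / 2"
proof -
  have "(\<Prod>j\<in>UNIV. end_weight (n $ j) (i $ j)) = 2 ^ card {j. 0 < i $ j \<and> i $ j < n $ j}"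
    by (simp add: end_weight_def prod.If_cases)
  then show ?thesis by (simp add: weight_def prod_dividef)
qed

lemma index_set_par_disjoint: "index_set_par 0 n \<inter> index_set_par 1 n = {}"
  by (auto simp: index_set_par_def cong_def)

text \<open>The index set is not a box, but each parity class is a product set, so the sum
  factorizes on each class separately.\<close>

lemma sum_index_set_prod:
  fixes n :: "nat ^ 'd"
  assumes "\<And>j. 1 \<le> n $ j"
  shows "(\<Sum>i\<in>index_set n. weight n i * (\<Prod>j\<in>UNIV. f j (i $ j))) =
    ((\<Prod>j\<in>UNIV. par_inner 0 (n $ j) (f j)) + (\<Prod>j\<in>UNIV. par_inner 1 (n $ j) (f j))) / 2"
proof -
  have part: "(\<Sum>i\<in>index_set_par r n. weight n i * (\<Prod>j\<in>UNIV. f j (i $ j))) =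
      (\<Prod>j\<in>UNIV. par_inner r (n $ j) (f j)) / 2" for r
  proof -
    have "(\<Sum>i\<in>index_set_par r n. weight n i * (\<Prod>j\<in>UNIV. f j (i $ j))) =
      (\<Sum>i | \<forall>j. i $ j \<in> {y. y \<le> n $ j \<and> [y = r] (mod 2)}.
        \<Prod>j\<in>UNIV. end_weight (n $ j) (i $ j) * f j (i $ j) / real (n $ j)) / 2"
      by (simp add: index_set_par_def weight_eq[OF assms] sum_divide_distrib prod.distrib[symmetric] mult_ac)
    also have "\<dots> = (\<Prod>j\<in>UNIV. par_inner r (n $ j) (f j)) / 2"
      by (subst sum_prod_vec) (auto simp: par_inner_def sum_divide_distrib)
    finally show ?thesis .
  qed
  have fin: "finite (index_set_par 0 n)" "finite (index_set_par 1 n)"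
    using finite_index_set[of n] by (auto simp: index_set_def)
  show ?thesis
    unfolding index_set_def
    by (simp only: sum.union_disjoint[OF fin index_set_par_disjoint] part) simp
qed

section \<open>The spectral set and its discrete norms\<close>

definition interior_spectrum :: "nat ^ 'd \<Rightarrow> (nat ^ 'd) set" where
  "interior_spectrum n = {\<gamma>. (\<forall>i. \<gamma> $ i < n $ i) \<and>
     (\<forall>i j. i \<noteq> j \<longrightarrow> real (\<gamma> $ i) / real (n $ i) + real (\<gamma> $ j) / real (n $ j) < 1)}"

definition top_freq :: "nat ^ 'd::{finite,linorder} \<Rightarrow> nat ^ 'd::{finite,linorder}" where
  "top_freq n = (\<chi> j. if j = last_index then n $ j else 0)"

lemma spectral_set_eq: "spectral_set n = insert (top_freq n) (interior_spectrum n)"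
  by (auto simp: spectral_set_def top_freq_def interior_spectrum_def)

lemma top_freq_notin: "top_freq n \<notin> interior_spectrum n"
  by (auto simp: top_freq_def interior_spectrum_def intro!: exI[of _ last_index])

lemma interior_spectrum_subset_box: "interior_spectrum n \<subseteq> box_set n"
  by (auto simp: interior_spectrum_def box_set_def less_imp_le)

lemma top_freq_in_box: "top_freq n \<in> box_set n"
  by (auto simp: top_freq_def box_set_def)

lemma spectral_set_subset_box: "spectral_set n \<subseteq> box_set n"
  using interior_spectrum_subset_box top_freq_in_box by (auto simp: spectral_set_eq)

lemma finite_spectral_set: "finite (spectral_set n)"
  using finite_subset[OF spectral_set_subset_box finite_box_set] .

text \<open>On the index set the top polynomial thus tells the classes apart: it is 1 on the even
  one and -1 on the odd one.\<close>

lemma grid_cheb_top: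
  assumes "\<And>j. 1 \<le> n $ j"
  shows "grid_cheb n (top_freq n) i = (-1) ^ (i $ last_index)"
proof -
  have "cos_grid (n $ j) (top_freq n $ j) (i $ j) = (if j = last_index then (-1) ^ (i $ j) else 1)" for j
    using cos_grid_add_period[OF assms, of j 0 "i $ j"] by (auto simp: top_freq_def cos_grid_def)
  then show ?thesis by (simp add: grid_cheb_def)
qed

text \<open>The squared norm of \<open>T_\<gamma>\<close> for the continuous inner product, see
  \<open>cheb_norm_cheb\<close>.\<close>

definition norm_coeff :: "nat ^ 'd \<Rightarrow> real" where
  "norm_coeff \<gamma> = (\<Prod>j\<in>UNIV. if \<gamma> $ j = 0 then 1 else 1 / 2)"

lemma norm_coeff_pos: "norm_coeff \<gamma> > 0"
  by (auto simp: norm_coeff_def intro!: prod_pos)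

text \<open>The squared norm for the discrete inner product. The top frequency is exceptional: its
  node values are all 1 or -1, and the weights have total mass 1.\<close>

definition disc_norm :: "nat ^ 'd::{finite,linorder} \<Rightarrow> nat ^ 'd::{finite,linorder} \<Rightarrow> real" where
  "disc_norm n \<gamma> = (if \<gamma> = top_freq n then 1 else norm_coeff \<gamma>)"

lemma disc_inner_interior:
  fixes n :: "nat ^ 'd"
  assumes n: "\<And>j. 1 \<le> n $ j" and "\<gamma> \<in> interior_spectrum n" "\<delta> \<in> interior_spectrum n"
  shows "(\<Sum>i\<in>index_set n. weight n i * (grid_cheb n \<gamma> i * grid_cheb n \<delta> i)) =
    of_bool (\<gamma> = \<delta>) * norm_coeff \<gamma>"
proof -
  define t where "t \<alpha> j = real (\<alpha> $ j) / real (n $ j)" for \<alpha> j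
  have t_lt: "t \<alpha> i + t \<alpha> j < 1" if "\<alpha> \<in> {\<gamma>, \<delta>}" "i \<noteq> j" for \<alpha> i j
    using assms that by (auto simp: interior_spectrum_def t_def)
  have t_eq: "t \<gamma> j + t \<delta> j = 1" if "\<gamma> $ j + \<delta> $ j = n $ j" for j
    using n[of j] that by (simp add: t_def add_divide_distrib[symmetric] of_nat_add[symmetric] del: of_nat_add)
  \<comment> \<open>Two reflected coordinates would make the four fractions add up to 2, although
    the pair sums of \<open>\<gamma>\<close> and of \<open>\<delta>\<close> are both below
    1.\<close>
  have not_two: "\<not> (\<gamma> $ i + \<delta> $ i = n $ i \<and> \<gamma> $ j + \<delta> $ j = n $ j)" if "i \<noteq> j" for i j
    using t_lt[of \<gamma> i j] t_lt[of \<delta> i j] t_eq[of i] t_eq[of j] that by auto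
  define q where "q r j = (of_bool (\<gamma> $ j = 0 \<and> \<delta> $ j = 0) + of_bool (\<gamma> $ j = \<delta> $ j) +
      (-1) ^ r * of_bool (\<gamma> $ j + \<delta> $ j = n $ j)) / (2 :: real)" for r j
  have "(\<Sum>i\<in>index_set n. weight n i * (grid_cheb n \<gamma> i * grid_cheb n \<delta> i)) =
    ((\<Prod>j\<in>UNIV. par_inner 0 (n $ j) (\<lambda>i. cos_grid (n $ j) (\<gamma> $ j) i * cos_grid (n $ j) (\<delta> $ j) i)) +
     (\<Prod>j\<in>UNIV. par_inner 1 (n $ j) (\<lambda>i. cos_grid (n $ j) (\<gamma> $ j) i * cos_grid (n $ j) (\<delta> $ j) i))) / 2"
    unfolding grid_cheb_def prod.distrib[symmetric] by (rule sum_index_set_prod[OF n])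
  also have "\<dots> = ((\<Prod>j\<in>UNIV. q 0 j) + (\<Prod>j\<in>UNIV. q 1 j)) / 2"
    using assms by (simp add: par_inner_cos_grid interior_spectrum_def q_def)
  also have "\<dots> = of_bool (\<gamma> = \<delta>) * norm_coeff \<gamma>"
  proof -
    \<comment> \<open>A reflected coordinate, where \<open>\<gamma>\<^sub>j + \<delta>\<^sub>j = n\<^sub>j\<close>, is unique; it is the only factor in which the
      two parity classes can differ.\<close>
    have "\<exists>j0. (\<gamma> = \<delta> \<or> \<gamma> $ j0 \<noteq> \<delta> $ j0) \<and> (\<forall>j. j \<noteq> j0 \<longrightarrow> q 1 j = q 0 j \<or> \<gamma> \<noteq> \<delta> \<and> q 0 j0 = 0 \<and> q 1 j0 = 0)"
    proof (cases "\<gamma> = \<delta>")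
      case True
      show ?thesis
      proof (cases "\<exists>j. \<gamma> $ j + \<delta> $ j = n $ j")
        case True
        then obtain j0 where "\<gamma> $ j0 + \<delta> $ j0 = n $ j0" by blast
        then have "\<gamma> $ j + \<delta> $ j \<noteq> n $ j" if "j \<noteq> j0" for j
          using not_two that by blast
        then show ?thesis using \<open>\<gamma> = \<delta>\<close> by (intro exI[of _ j0]) (auto simp: q_def)
      next
        case False
        then show ?thesis using \<open>\<gamma> = \<delta>\<close> by (simp add: q_def)
      qed
    next
      case False
      then obtain j0 where j0: "\<gamma> $ j0 \<noteq> \<delta> $ j0" by (auto simp: vec_eq_iff)
      \<comment> \<open>If the differing coordinate \<open>j0\<close> is reflected, no other one is.
        Otherwise its factor vanishes in both classes, and with it both products.\<close>
      show ?thesis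
      proof (cases "\<gamma> $ j0 + \<delta> $ j0 = n $ j0")
        case True
        then have "\<gamma> $ j + \<delta> $ j \<noteq> n $ j" if "j \<noteq> j0" for j
          using not_two that by blast
        then show ?thesis using j0 by (intro exI[of _ j0]) (auto simp: q_def)
      next
        case False
        then have "q r j0 = 0" for r using j0 by (auto simp: q_def)
        then show ?thesis using j0 by auto
      qed
    qed
    then obtain j0 where j0: "\<gamma> = \<delta> \<or> \<gamma> $ j0 \<noteq> \<delta> $ j0"
      "\<And>j. j \<noteq> j0 \<Longrightarrow> q 1 j = q 0 j \<or> \<gamma> \<noteq> \<delta> \<and> q 0 j0 = 0 \<and> q 1 j0 = 0" by blast
    have split: "prod (q r) UNIV = q r j0 * prod (q r) (UNIV - {j0})" for r
      by (rule prod.remove) auto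
    \<comment> \<open>The reflected terms carry opposite signs in the two classes and
      cancel.\<close>
    have q01: "q 0 j + q 1 j = of_bool (\<gamma> $ j = 0 \<and> \<delta> $ j = 0) + of_bool (\<gamma> $ j = \<delta> $ j)" for j
      by (simp add: q_def)
    show ?thesis
    proof (cases "\<gamma> \<noteq> \<delta> \<and> q 0 j0 = 0 \<and> q 1 j0 = 0")
      case True
      then show ?thesis by (simp add: split)
    next
      case False
      then have "prod (q 1) (UNIV - {j0}) = prod (q 0) (UNIV - {j0})"
        using j0(2) by (intro prod.cong) auto
      \<comment> \<open>Away from \<open>j0\<close> the classes agree, so the averaging takes place
        in the single factor \<open>j0\<close>.\<close>
      then have eq: "(prod (q 0) UNIV + prod (q 1) UNIV) / 2 =
          (q 0 j0 + q 1 j0) / 2 * prod (q 0) (UNIV - {j0})"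
        by (simp add: split algebra_simps)
      show ?thesis
      proof (cases "\<gamma> = \<delta>")
        case True
        have q_eq: "(q 0 j + q 1 j) / 2 = (if \<gamma> $ j = 0 then 1 else 1 / 2)" for j
          unfolding q01 using True by simp
        have "q 0 j = (if \<gamma> $ j = 0 then 1 else 1 / 2)" if "j \<noteq> j0" for j
          using q_eq[of j] j0(2)[OF that] True by auto
        then have "prod (q 0) (UNIV - {j0}) = (\<Prod>j\<in>UNIV - {j0}. if \<gamma> $ j = 0 then 1 else 1 / 2)"
          by (intro prod.cong) auto
        then show ?thesis
          unfolding eq q_eq norm_coeff_def using True prod.remove[of UNIV j0 "\<lambda>j. if \<gamma> $ j = 0 then 1 else 1 / 2 :: real"]
          by simp
      next
        case False
        then have "q 0 j0 + q 1 j0 = 0" using j0(1) unfolding q01 by auto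
        then show ?thesis unfolding eq using False by simp
      qed
    qed
  qed
  finally show ?thesis .
qed

lemma zero_in_interior:
  assumes "\<And>j. 1 \<le> n $ j"
  shows "0 \<in> interior_spectrum n"
  using assms by (auto simp: interior_spectrum_def Suc_le_eq)

lemma grid_cheb_zero: "grid_cheb n 0 i = 1"
  by (simp add: grid_cheb_def cos_grid_def)

lemma index_set_parity:
  assumes "i \<in> index_set n"
  shows "(-1 :: real) ^ (i $ j) = (-1) ^ (i $ k)"
  using assms
  by (auto simp: index_set_def index_set_par_def cong_def minus_one_power_iff even_iff_mod_2_eq_zero)

text \<open>What remains is the top frequency, whose polynomial is \<open>(-1) ^ r\<close> on the
  class of \<open>r\<close>. Paired with an interior \<open>\<delta>\<close>, the two classes
  contribute opposite amounts.\<close>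

lemma disc_inner:
  fixes n :: "nat ^ 'd::{finite,linorder}"
  assumes n: "\<And>j. 1 \<le> n $ j" and "\<gamma> \<in> spectral_set n" "\<delta> \<in> spectral_set n"
  shows "(\<Sum>i\<in>index_set n. weight n i * (grid_cheb n \<gamma> i * grid_cheb n \<delta> i)) =
    of_bool (\<gamma> = \<delta>) * disc_norm n \<gamma>"
proof -
  have top: "(\<Sum>i\<in>index_set n. weight n i * (grid_cheb n (top_freq n) i * grid_cheb n \<delta> i)) = 0"
    if "\<delta> \<in> interior_spectrum n" for \<delta>
  proof -
    let ?c = "\<lambda>j i. (if j = last_index then (-1) ^ i else 1) * cos_grid (n $ j) (\<delta> $ j) i"
    have \<delta>: "\<delta> $ j < n $ j" for j using that by (auto simp: interior_spectrum_def)
    have c: "grid_cheb n (top_freq n) i * grid_cheb n \<delta> i = (\<Prod>j\<in>UNIV. ?c j (i $ j))" for i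
      unfolding grid_cheb_top[OF n] by (simp add: grid_cheb_def prod.distrib)
    have p: "par_inner r (n $ j) (?c j) = (if j = last_index then (-1) ^ r else 1) *
        of_bool (\<delta> $ j = 0)" if "r \<in> {0, 1}" for r j
    proof -
      have r: "par_inner r (n $ j) (cos_grid (n $ j) (\<delta> $ j)) = of_bool (\<delta> $ j = 0)"
        using par_inner_cos_grid[OF n[of j], of 0 "\<delta> $ j" r] n[of j] \<delta>[of j] that
        by (auto simp: cos_grid_def[of _ 0])
      have "(-1) ^ i = (-1 :: real) ^ r" if "[i = r] (mod 2)" for i
        using that by (simp add: cong_def minus_one_power_iff even_iff_mod_2_eq_zero)
      then have "par_inner r m (\<lambda>i. (-1) ^ i * f i) = par_inner r m (\<lambda>i. (-1) ^ r * f i)" for m f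
        unfolding par_inner_def by (intro arg_cong2[where f = "(/)"] sum.cong refl) (metis mem_Collect_eq)
      then have "par_inner r m (\<lambda>i. (-1) ^ i * f i) = (-1) ^ r * par_inner r m f" for m f
        by (simp add: par_inner_def sum_distrib_left mult_ac)
      with r show ?thesis by (cases "j = last_index") simp_all
    qed
    show ?thesis
      unfolding c sum_index_set_prod[OF n, of ?c] by (simp add: p prod.distrib)
  qed
  have top_top: "(\<Sum>i\<in>index_set n. weight n i * (grid_cheb n (top_freq n) i * grid_cheb n (top_freq n) i)) = 1"
  proof -
    \<comment> \<open>A squared sign is 1, so this norm is that of the constant polynomial.\<close>
    have "grid_cheb n (top_freq n) i * grid_cheb n (top_freq n) i = grid_cheb n 0 i * grid_cheb n 0 i" for i
      by (simp add: grid_cheb_top[OF n] grid_cheb_zero power_mult_distrib[symmetric])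
    then show ?thesis
      using disc_inner_interior[OF n zero_in_interior[OF n] zero_in_interior[OF n]]
      by (simp add: norm_coeff_def)
  qed
  consider "\<gamma> = top_freq n" "\<delta> = top_freq n" | "\<gamma> = top_freq n" "\<delta> \<in> interior_spectrum n"
    | "\<delta> = top_freq n" "\<gamma> \<in> interior_spectrum n" | "\<gamma> \<in> interior_spectrum n" "\<delta> \<in> interior_spectrum n"
    using assms by (auto simp: spectral_set_eq)
  then show ?thesis
  proof cases
    case 1
    then show ?thesis by (simp only: top_top) (simp add: disc_norm_def)
  next
    case 2
    then show ?thesis using top[of \<delta>] top_freq_notin[of n] by auto
  next
    case 3
    then show ?thesis using top[of \<gamma>] top_freq_notin[of n] by (auto simp: mult.commute)
  next
    case 4
    then show ?thesis using disc_inner_interior[OF n] top_freq_notin[of n] by (auto simp: disc_norm_def)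
  qed
qed

subsection \<open>Reduction to the spectral set\<close>

text \<open>Each reflection contributes the sign \<open>(-1) ^ (i $ j)\<close>. All entries of an
  index have the same parity, so the two signs cancel.\<close>

lemma grid_cheb_reflect_pair:
  fixes n :: "nat ^ 'd"
  assumes n: "\<And>j. 1 \<le> n $ j" and "\<gamma> \<in> box_set n" "i \<in> index_set n" "a \<noteq> b"
  shows "grid_cheb n (\<chi> j. if j \<in> {a, b} then n $ j - \<gamma> $ j else \<gamma> $ j) i = grid_cheb n \<gamma> i"
proof -
  have "cos_grid (n $ j) (if j \<in> {a, b} then n $ j - \<gamma> $ j else \<gamma> $ j) (i $ j) =
      (if j \<in> {a, b} then (-1) ^ (i $ j) else 1) * cos_grid (n $ j) (\<gamma> $ j) (i $ j)" for j
    using assms by (simp add: box_set_def cos_grid_reflect)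
  moreover have "(\<Prod>j\<in>UNIV. if j \<in> {a, b} then (-1) ^ (i $ j) else 1) = (1 :: real)"
  proof -
    have "(\<Prod>j\<in>UNIV. if j \<in> {a, b} then (-1) ^ (i $ j) else 1) = (\<Prod>j\<in>{a, b}. (-1 :: real) ^ (i $ j))"
      by (rule prod.mono_neutral_cong_right) auto
    also have "\<dots> = (-1) ^ (i $ a) * (-1) ^ (i $ a)"
      using assms(4) index_set_parity[OF assms(3), of b a] by simp
    finally show ?thesis by (simp add: power_mult_distrib[symmetric])
  qed
  ultimately show ?thesis by (simp add: grid_cheb_def prod.distrib)
qed

text \<open>Clearing denominators gives \<open>a * k + b * m = m * k\<close>, so \<open>m\<close>
  divides \<open>a * k\<close> and, by coprimality, \<open>a\<close>.\<close>

lemma coprime_fraction_sum_one: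
  fixes a b m k :: nat
  assumes "coprime m k" "1 \<le> m" "1 \<le> k" "a \<le> m" "real a / real m + real b / real k = 1"
  shows "a = 0 \<or> a = m"
proof -
  have "real a * real k + real b * real m = real m * real k"
    using assms by (simp add: field_simps)
  then have "a * k + b * m = m * k" by (metis of_nat_add of_nat_eq_iff of_nat_mult)
  then have "m dvd a * k" by (metis dvd_add_left_iff dvd_triv_left dvd_triv_right)
  then have "m dvd a" using assms(1) by (simp add: coprime_dvd_mult_left_iff)
  then show ?thesis using assms(4) by (auto dest: dvd_imp_le)
qed

lemma grid_cheb_reduce:
  fixes n :: "nat ^ 'd::{finite,linorder}"
  assumes n: "\<And>j. 1 \<le> n $ j"
    and coprime: "\<And>i j. i \<noteq> j \<Longrightarrow> coprime (n $ i) (n $ j)"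
    and "\<gamma> \<in> box_set n"
  shows "\<exists>\<delta>\<in>spectral_set n. \<forall>i\<in>index_set n. grid_cheb n \<delta> i = grid_cheb n \<gamma> i"
proof -
  \<comment> \<open>Minimizing \<open>\<Sum>\<^sub>j \<delta>\<^sub>j / n\<^sub>j\<close> forces every pair sum to be at most \<open>1\<close>.\<close>
  define S where "S = {\<delta> \<in> box_set n. \<forall>i\<in>index_set n. grid_cheb n \<delta> i = grid_cheb n \<gamma> i}"
  define t where "t \<delta> j = real (\<delta> $ j) / real (n $ j)" for \<delta> j
  have "finite S" "S \<noteq> {}" using finite_box_set[of n] assms by (auto simp: S_def)
  then obtain \<delta> where \<delta>: "\<delta> \<in> S" and min: "\<And>\<alpha>. \<alpha> \<in> S \<Longrightarrow> sum (t \<delta>) UNIV \<le> sum (t \<alpha>) UNIV"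
    using ex_is_arg_min_if_finite[of S "\<lambda>\<delta>. sum (t \<delta>) UNIV"] by (auto simp: is_arg_min_linorder)
  have \<delta>_le: "\<delta> $ j \<le> n $ j" for j using \<delta> by (auto simp: S_def box_set_def)
  have t_nonneg: "0 \<le> t \<delta> j" for j by (simp add: t_def)
  have reflect: "(\<chi> j. if j \<in> {a, b} then n $ j - \<delta> $ j else \<delta> $ j) \<in> S" if "a \<noteq> b" for a b
    using \<delta> that grid_cheb_reflect_pair[OF n _ _ that] by (auto simp: S_def box_set_def)
  have pair_le: "t \<delta> a + t \<delta> b \<le> 1" if "a \<noteq> b" for a b
  proof -
    define \<alpha> where "\<alpha> = (\<chi> j. if j \<in> {a, b} then n $ j - \<delta> $ j else \<delta> $ j)"
    have "t \<alpha> j = t \<delta> j + (if j \<in> {a, b} then 1 - 2 * t \<delta> j else 0)" for j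
      using n[of j] \<delta>_le[of j] by (simp add: \<alpha>_def t_def of_nat_diff diff_divide_distrib)
    then have "sum (t \<alpha>) UNIV = sum (t \<delta>) UNIV + (\<Sum>j\<in>UNIV. if j \<in> {a, b} then 1 - 2 * t \<delta> j else 0)"
      by (simp add: sum.distrib[symmetric])
    also have "(\<Sum>j\<in>UNIV. if j \<in> {a, b} then 1 - 2 * t \<delta> j else 0) = (\<Sum>j\<in>{a, b}. 1 - 2 * t \<delta> j)"
      by (rule sum.mono_neutral_cong_right) auto
    \<comment> \<open>The reflection changes the total by
      \<open>2 - 2 * (t \<delta> a + t \<delta> b)\<close>, which minimality forces to be
      nonnegative.\<close>
    finally show ?thesis using min[OF reflect[OF that]] that by (simp add: \<alpha>_def)
  qed
  show ?thesis
  proof (cases "\<exists>a. \<delta> $ a = n $ a")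
    case True
    then obtain a where a: "\<delta> $ a = n $ a" by blast
    \<comment> \<open>A full coordinate already exhausts the bound 1 of every pair containing
      it.\<close>
    have "\<delta> $ j = 0" if "j \<noteq> a" for j
      using pair_le[of a j] a that t_nonneg[of j] n[of a] n[of j] by (auto simp: t_def divide_le_0_iff)
    with a have \<delta>_eq: "\<delta> = (\<chi> j. if j = a then n $ j else 0)" by (auto simp: vec_eq_iff)
    have "top_freq n \<in> S"
    proof (cases "a = last_index")
      case True
      then show ?thesis using \<delta> \<delta>_eq by (simp add: top_freq_def)
    next
      case False
      \<comment> \<open>Reflecting \<open>a\<close> together with \<open>last_index\<close> moves
        the full entry to the last coordinate.\<close>
      have "top_freq n = (\<chi> j. if j \<in> {a, last_index} then n $ j - \<delta> $ j else \<delta> $ j)"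
        using False by (auto simp: top_freq_def \<delta>_eq vec_eq_iff)
      then show ?thesis using reflect[OF False] by simp
    qed
    then show ?thesis by (auto simp: S_def spectral_set_eq)
  next
    case False
    then have lt: "\<delta> $ j < n $ j" for j using \<delta>_le[of j] by (auto simp: le_less)
    \<comment> \<open>Coprimality leaves only 0 and \<open>n $ a\<close> for
      \<open>\<delta> $ a\<close>. The latter is excluded, and the former would make coordinate
      \<open>b\<close> full.\<close>
    have "t \<delta> a + t \<delta> b \<noteq> 1" if "a \<noteq> b" for a b
    proof
      assume eq: "t \<delta> a + t \<delta> b = 1"
      then have "\<delta> $ a = 0"
        using coprime_fraction_sum_one[OF coprime[OF that] n n \<delta>_le] lt[of a] by (auto simp: t_def)
      with eq n[of b] have "\<delta> $ b = n $ b" by (simp add: t_def)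
      with lt[of b] show False by simp
    qed
    with pair_le lt have "\<delta> \<in> interior_spectrum n"
      by (fastforce simp: interior_spectrum_def t_def less_le)
    then show ?thesis using \<delta> by (auto simp: S_def spectral_set_eq)
  qed
qed

section \<open>Delta functions and the discrete reproducing kernel\<close>

lemma delta_grid_cheb:
  fixes n :: "nat ^ 'd"
  assumes n: "\<And>j. 1 \<le> n $ j" and k: "k \<in> box_set n"
  shows "\<exists>c. \<forall>i\<in>box_set n. (\<Sum>\<gamma>\<in>box_set n. c \<gamma> * grid_cheb n \<gamma> i) = of_bool (i = k)"
proof -
  \<comment> \<open>The tensor product of the one-dimensional inversion coefficients from
    \<open>sum_end_weight_delta\<close>.\<close>
  define c where "c \<gamma> = (\<Prod>j\<in>UNIV. end_weight (n $ j) (k $ j) / (2 * real (n $ j)) *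
      (end_weight (n $ j) (\<gamma> $ j) * cos_grid (n $ j) (\<gamma> $ j) (k $ j)))" for \<gamma> :: "nat ^ 'd"
  have "(\<Sum>\<gamma>\<in>box_set n. c \<gamma> * grid_cheb n \<gamma> i) = of_bool (i = k)" if i: "i \<in> box_set n" for i
  proof -
    have "(\<Sum>\<gamma>\<in>box_set n. c \<gamma> * grid_cheb n \<gamma> i) =
        (\<Sum>\<gamma> | \<forall>j. \<gamma> $ j \<in> {..n $ j}. \<Prod>j\<in>UNIV. end_weight (n $ j) (k $ j) / (2 * real (n $ j)) *
          (end_weight (n $ j) (\<gamma> $ j) * (cos_grid (n $ j) (\<gamma> $ j) (k $ j) * cos_grid (n $ j) (\<gamma> $ j) (i $ j))))"
      by (simp add: box_set_def c_def grid_cheb_def prod.distrib[symmetric] mult_ac)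
    also have "\<dots> = (\<Prod>j\<in>UNIV. end_weight (n $ j) (k $ j) / (2 * real (n $ j)) *
        (\<Sum>g\<le>n $ j. end_weight (n $ j) g * (cos_grid (n $ j) g (k $ j) * cos_grid (n $ j) g (i $ j))))"
      by (subst sum_prod_vec) (simp_all only: finite_atMost sum_distrib_left)
    also have "\<dots> = (\<Prod>j\<in>UNIV. of_bool (i $ j = k $ j))"
      using i k by (intro prod.cong refl sum_end_weight_delta n) (auto simp: box_set_def)
    also have "\<dots> = of_bool (i = k)"
      by (auto simp: vec_eq_iff)
    finally show ?thesis .
  qed
  then show ?thesis by blast
qed

text \<open>The reproducing kernel of the spectral polynomials for the discrete inner
  product.\<close>

definition disc_kernel ::
  "nat ^ 'd::{finite,linorder} \<Rightarrow> nat ^ 'd::{finite,linorder} \<Rightarrow> nat ^ 'd::{finite,linorder} \<Rightarrow> real" where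
  "disc_kernel n i k = (\<Sum>\<gamma>\<in>spectral_set n. grid_cheb n \<gamma> i * grid_cheb n \<gamma> k / disc_norm n \<gamma>)"

lemma disc_norm_pos: "disc_norm n \<gamma> > 0"
  by (simp add: disc_norm_def norm_coeff_pos)

lemma disc_kernel_reproduces:
  fixes n :: "nat ^ 'd::{finite,linorder}"
  assumes n: "\<And>j. 1 \<le> n $ j" and "\<gamma> \<in> spectral_set n"
  shows "(\<Sum>i\<in>index_set n. weight n i * grid_cheb n \<gamma> i * disc_kernel n i k) = grid_cheb n \<gamma> k"
proof -
  have "(\<Sum>i\<in>index_set n. weight n i * grid_cheb n \<gamma> i * disc_kernel n i k) =
      (\<Sum>i\<in>index_set n. \<Sum>\<delta>\<in>spectral_set n.
        weight n i * (grid_cheb n \<gamma> i * grid_cheb n \<delta> i) * (grid_cheb n \<delta> k / disc_norm n \<delta>))"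
    by (simp add: disc_kernel_def sum_distrib_left mult_ac)
  also have "\<dots> = (\<Sum>\<delta>\<in>spectral_set n. (\<Sum>i\<in>index_set n. weight n i * (grid_cheb n \<gamma> i * grid_cheb n \<delta> i))
      * (grid_cheb n \<delta> k / disc_norm n \<delta>))"
    by (subst sum.swap) (simp only: sum_distrib_right)
  also have "\<dots> = (\<Sum>\<delta>\<in>spectral_set n. if \<delta> = \<gamma> then grid_cheb n \<gamma> k else 0)"
    using disc_norm_pos[of n] by (intro sum.cong) (auto simp: disc_inner[OF n assms(2)] less_imp_neq[symmetric])
  also have "\<dots> = grid_cheb n \<gamma> k"
    using assms(2) finite_spectral_set[of n] by simp
  finally show ?thesis .
qed

text \<open>By reduction to the spectral set, the kernel reproduces the node values of every
  frequency in the box. The delta function at \<open>i\<close> is a combination of these, and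
  reproducing it at \<open>k\<close> gives the claim.\<close>

lemma weight_disc_kernel:
  fixes n :: "nat ^ 'd::{finite,linorder}"
  assumes n: "\<And>j. 1 \<le> n $ j"
    and coprime: "\<And>i j. i \<noteq> j \<Longrightarrow> coprime (n $ i) (n $ j)"
    and i: "i \<in> index_set n" and k: "k \<in> index_set n"
  shows "weight n i * disc_kernel n i k = of_bool (i = k)"
proof -
  have rep: "(\<Sum>l\<in>index_set n. weight n l * grid_cheb n \<gamma> l * disc_kernel n l k) = grid_cheb n \<gamma> k"
    if \<gamma>: "\<gamma> \<in> box_set n" for \<gamma>
  proof -
    obtain \<delta> where \<delta>: "\<delta> \<in> spectral_set n" "\<forall>l\<in>index_set n. grid_cheb n \<delta> l = grid_cheb n \<gamma> l"
      using grid_cheb_reduce[OF n coprime \<gamma>] by blast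
    then show ?thesis using disc_kernel_reproduces[OF n \<delta>(1), of k] k by simp
  qed
  have box: "l \<in> box_set n" if "l \<in> index_set n" for l
    using that index_set_subset_box by blast
  obtain c where c: "\<And>l. l \<in> box_set n \<Longrightarrow> (\<Sum>\<gamma>\<in>box_set n. c \<gamma> * grid_cheb n \<gamma> l) = of_bool (l = i)"
    using delta_grid_cheb[OF n box[OF i]] by blast
  have "weight n i * disc_kernel n i k =
      (\<Sum>l\<in>index_set n. if l = i then weight n l * disc_kernel n l k else 0)"
    using i finite_index_set[of n] by simp
  also have "\<dots> = (\<Sum>l\<in>index_set n. \<Sum>\<gamma>\<in>box_set n.
      c \<gamma> * (weight n l * grid_cheb n \<gamma> l * disc_kernel n l k))"
  proof (rule sum.cong[OF refl])
    fix l assume l: "l \<in> index_set n"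
    have "(\<Sum>\<gamma>\<in>box_set n. c \<gamma> * (weight n l * grid_cheb n \<gamma> l * disc_kernel n l k)) =
        (\<Sum>\<gamma>\<in>box_set n. c \<gamma> * grid_cheb n \<gamma> l) * (weight n l * disc_kernel n l k)"
      unfolding sum_distrib_right by (simp add: mult_ac)
    then show "(if l = i then weight n l * disc_kernel n l k else 0) =
        (\<Sum>\<gamma>\<in>box_set n. c \<gamma> * (weight n l * grid_cheb n \<gamma> l * disc_kernel n l k))"
      using c[OF box[OF l]] by simp
  qed
  also have "\<dots> = (\<Sum>\<gamma>\<in>box_set n. c \<gamma> * grid_cheb n \<gamma> k)"
    by (subst sum.swap) (simp add: sum_distrib_left[symmetric] rep)
  also have "\<dots> = of_bool (i = k)"
    using c[OF box[OF k]] by auto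
  finally show ?thesis .
qed

subsection \<open>Norms of the Chebyshev polynomials\<close>

text \<open>As \<open>arccos\<close> is specified only on \<open>[-1,1]\<close>, measurability comes
  from continuity there, and the indicator cuts off the rest.\<close>

lemma borel_measurable_cos_arccos_square:
  "(\<lambda>x. indicator {-1..1} x * cos (real k * arccos x) ^ 2) \<in> borel_measurable borel"
proof -
  have "continuous_on {-1..1} (\<lambda>x. cos (real k * arccos x) ^ 2)"
    by (intro continuous_intros) auto
  then have "(\<lambda>x. indicator {-1..1} x *\<^sub>R cos (real k * arccos x) ^ 2) \<in> borel_measurable borel"
    by (intro borel_measurable_continuous_on_indicator) auto
  then show ?thesis by simp
qed

text \<open>The substitution \<open>x = cos t\<close> suggests the antiderivatives. The density is
  singular at the end points, hence the interior form of the fundamental theorem.\<close>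

lemma has_integral_cheb1_square:
  "((\<lambda>x. cheb1 k x ^ 2 / sqrt (1 - x\<^sup>2)) has_integral (if k = 0 then pi else pi / 2)) {-1..1}"
proof (cases "k = 0")
  case True
  have "((\<lambda>x. 1 / sqrt (1 - x\<^sup>2)) has_integral (- arccos 1 - - arccos (-1))) {-1..1}"
  proof (rule fundamental_theorem_of_calculus_interior)
    show "continuous_on {-1..1} (\<lambda>x. - arccos x)" by (intro continuous_intros) auto
    fix x :: real assume x: "x \<in> {-1<..<1}"
    have "((\<lambda>x. - arccos x) has_real_derivative 1 / sqrt (1 - x\<^sup>2)) (at x)"
      using x by (auto intro!: derivative_eq_intros simp: divide_simps)
    then show "((\<lambda>x. - arccos x) has_vector_derivative 1 / sqrt (1 - x\<^sup>2)) (at x)"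
      by (simp add: has_real_derivative_iff_has_vector_derivative)
  qed auto
  then show ?thesis using True by (simp add: cheb1_def)
next
  case False
  \<comment> \<open>With \<open>t = arccos x\<close> this is minus the antiderivative
    \<open>t / 2 + sin (2 * k * t) / (4 * k)\<close> of \<open>cos (k * t) ^ 2\<close>.\<close>
  define F where "F x = - (arccos x / 2) - sin (2 * (real k * arccos x)) / (4 * real k)" for x
  have "((\<lambda>x. cheb1 k x ^ 2 / sqrt (1 - x\<^sup>2)) has_integral (F 1 - F (-1))) {-1..1}"
  proof (rule fundamental_theorem_of_calculus_interior)
    show "continuous_on {-1..1} F" unfolding F_def using False by (intro continuous_intros) auto
    fix x :: real assume x: "x \<in> {-1<..<1}"
    have "(F has_real_derivative (1/2 + cos (2 * (real k * arccos x)) / 2) / sqrt (1 - x\<^sup>2)) (at x)"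
      unfolding F_def using x False by (auto intro!: derivative_eq_intros simp: divide_simps) (simp add: algebra_simps)
    moreover have "1/2 + cos (2 * (real k * arccos x)) / 2 = cheb1 k x ^ 2"
      unfolding cheb1_def by (simp only: cos_double_cos) (simp add: field_simps)
    ultimately show "(F has_vector_derivative cheb1 k x ^ 2 / sqrt (1 - x\<^sup>2)) (at x)"
      by (simp add: has_real_derivative_iff_has_vector_derivative)
  qed auto
  moreover have "F 1 - F (-1) = pi / 2"
    using sin_npi[of "2 * k"] by (simp add: F_def mult.assoc)
  ultimately show ?thesis using False by simp
qed

text \<open>Cut off outside \<open>[-1,1]\<close>, so that the integral over the cube becomes a
  product integral over the whole space.\<close>

definition cheb_dens :: "nat \<Rightarrow> real \<Rightarrow> real" where
  "cheb_dens k x = indicator {-1..1} x * (cheb1 k x ^ 2 / sqrt (1 - x\<^sup>2))"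

lemma cheb_dens_measurable [measurable]: "cheb_dens k \<in> borel_measurable borel"
proof -
  have eq: "cheb_dens k = (\<lambda>x. (indicator {-1..1} x * cos (real k * arccos x) ^ 2) / sqrt (1 - x\<^sup>2))"
    by (auto simp: cheb_dens_def cheb1_def)
  show ?thesis unfolding eq
    by (rule borel_measurable_divide[OF borel_measurable_cos_arccos_square]) measurable
qed

lemma cheb_dens_nonneg: "cheb_dens k x \<ge> 0"
proof (cases "x \<in> {-1..1}")
  case True
  then have "\<bar>x\<bar> \<le> 1" by auto
  then have "x\<^sup>2 \<le> 1" by (simp add: abs_square_le_1)
  then show ?thesis by (simp add: cheb_dens_def)
qed (simp add: cheb_dens_def)

lemma nn_integral_cheb_dens:
  "(\<integral>\<^sup>+x. ennreal (cheb_dens k x) \<partial>lborel) = ennreal (if k = 0 then pi else pi / 2)"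
proof -
  have hi: "(cheb_dens k has_integral (if k = 0 then pi else pi / 2)) {-1..1}"
    by (rule has_integral_eq[OF _ has_integral_cheb1_square]) (auto simp: cheb_dens_def)
  have "(cheb_dens k has_integral (if k = 0 then pi else pi / 2)) UNIV"
    by (rule has_integral_on_superset[OF hi]) (auto simp: cheb_dens_def)
  then show ?thesis
    by (intro nn_integral_has_integral_lborel) (auto simp: cheb_dens_nonneg)
qed

text \<open>The integrand is a nonnegative product of univariate densities, so Tonelli factorizes
  the integral; the normalization removes one \<open>pi\<close> per coordinate.\<close>

lemma cheb_norm_cheb:
  fixes \<gamma> :: "nat ^ 'd"
  shows "(cheb_norm (cheb \<gamma>))\<^sup>2 = (\<Prod>j\<in>UNIV. if \<gamma> $ j = 0 then 1 else 1 / 2)"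
proof -
  let ?c = "\<lambda>j. if \<gamma> $ j = 0 then pi else pi / 2"
  \<comment> \<open>The factors in \<open>nn_integral_lborel_prod\<close> are indexed by basis
    vectors, so the coordinate is recovered from \<open>b\<close>.\<close>
  define f where "f b = cheb_dens (\<gamma> $ (THE j. b = axis j 1))" for b :: "real ^ 'd"
  have f_axis: "f (axis j 1) = cheb_dens (\<gamma> $ j)" for j
  proof -
    have "(THE i. axis j (1::real) = axis i 1) = j"
      by (rule the_equality) (auto simp: axis_eq_axis)
    then show ?thesis by (simp add: f_def)
  qed
  have Basis: "(Basis :: (real ^ 'd) set) = range (\<lambda>j. axis j 1)"
    by (auto simp: Basis_vec_def)
  have inj: "inj (\<lambda>j. axis j (1::real) :: real ^ 'd)"
    by (auto simp: inj_def axis_eq_axis)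
  have nn: "(\<integral>\<^sup>+x. ennreal (\<Prod>j\<in>UNIV. cheb_dens (\<gamma> $ j) (x $ j)) \<partial>(lborel :: (real ^ 'd) measure)) =
      ennreal (\<Prod>j\<in>UNIV. ?c j)"
  proof -
    have "(\<integral>\<^sup>+x. (\<Prod>b\<in>Basis. ennreal (f b (x \<bullet> b))) \<partial>(lborel :: (real ^ 'd) measure)) =
        (\<Prod>b\<in>(Basis :: (real ^ 'd) set). (\<integral>\<^sup>+x. ennreal (f b x) \<partial>lborel))"
      by (rule nn_integral_lborel_prod) (auto simp: f_def)
    then show ?thesis
      unfolding Basis by (simp add: prod.reindex[OF inj] f_axis nn_integral_cheb_dens prod_ennreal
        cheb_dens_nonneg inner_axis)
  qed
  have int: "(LINT x|lborel. (\<Prod>j\<in>UNIV. cheb_dens (\<gamma> $ j) (x $ j))) = (\<Prod>j\<in>UNIV. ?c j)"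
  proof -
    have "(LINT x|lborel. (\<Prod>j\<in>UNIV. cheb_dens (\<gamma> $ j) (x $ j))) =
      enn2real (\<integral>\<^sup>+x. ennreal (\<Prod>j\<in>UNIV. cheb_dens (\<gamma> $ j) (x $ j)) \<partial>(lborel :: (real ^ 'd) measure))"
      by (rule integral_eq_nn_integral) (auto intro!: prod_nonneg cheb_dens_nonneg)
    then show ?thesis unfolding nn by (simp add: prod_nonneg)
  qed
  have pw: "indicator cube x *\<^sub>R (cheb \<gamma> x * cnj (cheb \<gamma> x) * of_real (\<Prod>j\<in>UNIV. 1 / sqrt (1 - (x $ j)\<^sup>2))) =
      complex_of_real (\<Prod>j\<in>UNIV. cheb_dens (\<gamma> $ j) (x $ j))" for x
  proof (cases "x \<in> cube")
    case True
    then have "cheb_dens (\<gamma> $ j) (x $ j) = cheb1 (\<gamma> $ j) (x $ j) * cheb1 (\<gamma> $ j) (x $ j) * (1 / sqrt (1 - (x $ j)\<^sup>2))" for j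
      by (auto simp: cheb_dens_def cube_def power2_eq_square)
    then show ?thesis using True
      by (simp only: cheb_def prod.distrib if_True complex_cnj_complex_of_real indicator_simps(1)
        scaleR_one flip: of_real_mult)
  next
    case False
    then obtain j where "x $ j \<notin> {-1..1}" by (auto simp: cube_def)
    then have "cheb_dens (\<gamma> $ j) (x $ j) = 0" by (simp add: cheb_dens_def)
    then have "(\<Prod>j\<in>UNIV. cheb_dens (\<gamma> $ j) (x $ j)) = 0" by (intro prod_zero) auto
    with False show ?thesis by (simp del: of_real_prod)
  qed
  have "cheb_inner (cheb \<gamma>) (cheb \<gamma>) = complex_of_real (1 / pi ^ CARD('d) * (\<Prod>j\<in>UNIV. ?c j))"
    unfolding cheb_inner_def set_lebesgue_integral_def pw integral_complex_of_real int
    by (simp only: of_real_mult)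
  also have "1 / pi ^ CARD('d) * (\<Prod>j\<in>UNIV. ?c j) = (\<Prod>j\<in>UNIV. ?c j / pi)"
    by (simp add: prod_dividef)
  also have "\<dots> = (\<Prod>j\<in>UNIV. if \<gamma> $ j = 0 then 1 else 1 / 2)"
    by (intro prod.cong) auto
  finally show ?thesis unfolding cheb_norm_def by (simp add: prod_nonneg del: of_real_prod)
qed

subsection \<open>Interpolation\<close>

lemma sum_fun_apply: "(\<Sum>a\<in>A. f a) x = (\<Sum>a\<in>A. f a x)"
  by (induction A rule: infinite_finite_induct) auto

lemma cheb_point_in: "-1 \<le> cheb_point m i" "cheb_point m i \<le> 1"
  by (simp_all add: cheb_point_def)

lemma node_in_cube: "node n i \<in> cube"
  by (simp add: node_def cube_def cheb_point_in)

lemma cheb1_cheb_point: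
  assumes "1 \<le> m" "i \<le> m"
  shows "cheb1 g (cheb_point m i) = cos_grid m g i"
proof -
  have "real i * pi / real m \<le> pi" using assms by (simp add: field_simps)
  then have "arccos (cheb_point m i) = real i * pi / real m"
    unfolding cheb_point_def by (intro arccos_cos) auto
  then show ?thesis by (simp add: cheb1_def cos_grid_def mult_ac)
qed

lemma cheb_node:
  assumes "\<And>j. 1 \<le> n $ j" "i \<in> box_set n"
  shows "cheb \<gamma> (node n i) = complex_of_real (grid_cheb n \<gamma> i)"
proof -
  have "cheb1 (\<gamma> $ j) (node n i $ j) = cos_grid (n $ j) (\<gamma> $ j) (i $ j)" for j
    using assms by (simp add: node_def cheb1_cheb_point box_set_def)
  then show ?thesis
    by (simp add: cheb_def node_in_cube grid_cheb_def)
qed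

text \<open>The two norms agree on the interior spectrum. At the top frequency the kernel has the
  factor 2, and the product subtracted in \<open>lagrange\<close> lowers it to the 1 that
  \<open>disc_norm\<close> demands.\<close>

lemma lagrange_eq:
  fixes n :: "nat ^ 'd::{finite,linorder}"
  assumes n: "\<And>j. 1 \<le> n $ j" and i: "i \<in> box_set n"
  shows "lagrange n i = (\<Sum>\<gamma>\<in>spectral_set n.
    cfun_scale (of_real (weight n i * grid_cheb n \<gamma> i / disc_norm n \<gamma>)) (cheb \<gamma>))"
proof (rule ext)
  fix x
  show "lagrange n i x = (\<Sum>\<gamma>\<in>spectral_set n.
      cfun_scale (of_real (weight n i * grid_cheb n \<gamma> i / disc_norm n \<gamma>)) (cheb \<gamma>)) x"
  proof (cases "x \<in> cube")
    case False
    then show ?thesis by (simp add: lagrange_def cfun_scale_def cheb_def sum_fun_apply)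
  next
    case True
    let ?l = "last_index :: 'd"
    have cheb_top: "cheb (top_freq n) y = of_real (cheb1 (n $ ?l) (y $ ?l))" if "y \<in> cube" for y
    proof -
      have "cheb1 (top_freq n $ j) (y $ j) = (if j = ?l then cheb1 (n $ j) (y $ j) else 1)" for j
        by (simp add: top_freq_def cheb1_def)
      then show ?thesis using that by (simp add: cheb_def del: of_real_prod)
    qed
    have norm_top: "norm_coeff (top_freq n) = 1 / 2"
    proof -
      have "(if top_freq n $ j = 0 then 1 else 1 / 2) = (if j = ?l then 1 / 2 else (1 :: real))" for j
        using n[of j] by (auto simp: top_freq_def)
      then show ?thesis by (simp add: norm_coeff_def)
    qed
    have fin: "finite (interior_spectrum n)"
      using finite_spectral_set[of n] by (simp add: spectral_set_eq)
    have "kernel n x (node n i) = (\<Sum>\<gamma>\<in>spectral_set n.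
        of_real (grid_cheb n \<gamma> i / norm_coeff \<gamma>) * cheb \<gamma> x)"
      unfolding kernel_def by (simp add: cheb_norm_cheb norm_coeff_def[symmetric] cheb_node[OF n i] mult_ac)
    also have "\<dots> = of_real (grid_cheb n (top_freq n) i / norm_coeff (top_freq n)) * cheb (top_freq n) x +
        (\<Sum>\<gamma>\<in>interior_spectrum n. of_real (grid_cheb n \<gamma> i / norm_coeff \<gamma>) * cheb \<gamma> x)"
      using fin top_freq_notin[of n] by (simp add: spectral_set_eq)
    also have "(\<Sum>\<gamma>\<in>interior_spectrum n. of_real (grid_cheb n \<gamma> i / norm_coeff \<gamma>) * cheb \<gamma> x) =
        (\<Sum>\<gamma>\<in>interior_spectrum n. of_real (grid_cheb n \<gamma> i / disc_norm n \<gamma>) * cheb \<gamma> x)"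
      using top_freq_notin[of n] by (intro sum.cong) (auto simp: disc_norm_def)
    finally have "kernel n x (node n i) - of_real (cheb1 (n $ ?l) (x $ ?l) * cheb1 (n $ ?l) (cheb_point (n $ ?l) (i $ ?l)))
       = of_real (grid_cheb n (top_freq n) i / disc_norm n (top_freq n)) * cheb (top_freq n) x +
        (\<Sum>\<gamma>\<in>interior_spectrum n. of_real (grid_cheb n \<gamma> i / disc_norm n \<gamma>) * cheb \<gamma> x)"
      using cheb_top[OF True] cheb_top[OF node_in_cube[of n i]] cheb_node[OF n i, of "top_freq n"]
      by (simp add: norm_top disc_norm_def node_def algebra_simps)
    also have "\<dots> = (\<Sum>\<gamma>\<in>spectral_set n. of_real (grid_cheb n \<gamma> i / disc_norm n \<gamma>) * cheb \<gamma> x)"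
      using fin top_freq_notin[of n] by (simp add: spectral_set_eq)
    finally show ?thesis
      using True by (simp add: lagrange_def cfun_scale_def sum_fun_apply sum_distrib_left mult_ac)
  qed
qed

lemma lagrange_in_poly_space:
  assumes "\<And>j. 1 \<le> n $ j" "i \<in> box_set n"
  shows "lagrange n i \<in> poly_space n"
  unfolding lagrange_eq[OF assms] poly_space_def
  by (intro cfun.span_sum cfun.span_scale cfun.span_base) auto

lemma interp_in_poly_space:
  assumes "\<And>j. 1 \<le> n $ j"
  shows "interp n h \<in> poly_space n"
  unfolding interp_def poly_space_def
  using lagrange_in_poly_space[OF assms] index_set_subset_box[of n]
  by (intro cfun.span_sum cfun.span_scale) (auto simp: poly_space_def)

lemma lagrange_node:
  fixes n :: "nat ^ 'd::{finite,linorder}"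
  assumes n: "\<And>j. 1 \<le> n $ j"
    and coprime: "\<And>i j. i \<noteq> j \<Longrightarrow> coprime (n $ i) (n $ j)"
    and i: "i \<in> index_set n" and k: "k \<in> index_set n"
  shows "lagrange n i (node n k) = of_bool (i = k)"
proof -
  have box: "i \<in> box_set n" "k \<in> box_set n" using i k index_set_subset_box by blast+
  have "lagrange n i (node n k) = complex_of_real (weight n i * disc_kernel n i k)"
    by (simp add: lagrange_eq[OF n box(1)] cfun_scale_def sum_fun_apply cheb_node[OF n box(2)]
      disc_kernel_def sum_distrib_left mult_ac)
  also have "weight n i * disc_kernel n i k = of_bool (i = k)"
    using n coprime i k by (rule weight_disc_kernel)
  finally show ?thesis by simp
qed

lemma interp_node:
  fixes n :: "nat ^ 'd::{finite,linorder}"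
  assumes n: "\<And>j. 1 \<le> n $ j"
    and coprime: "\<And>i j. i \<noteq> j \<Longrightarrow> coprime (n $ i) (n $ j)"
    and k: "k \<in> index_set n"
  shows "interp n h (node n k) = h k"
proof -
  have "interp n h (node n k) = (\<Sum>i\<in>index_set n. if i = k then h k else 0)"
    unfolding interp_def sum_fun_apply
    using lagrange_node[OF n coprime _ k] by (intro sum.cong) (auto simp: cfun_scale_def)
  then show ?thesis using k finite_index_set[of n] by simp
qed

text \<open>After exchanging the sums, the coefficient of \<open>cheb \<delta>\<close> is a discrete
  inner product with \<open>\<gamma>\<close>, so only \<open>\<delta> = \<gamma>\<close> is
  left.\<close>

lemma interp_cheb:
  fixes n :: "nat ^ 'd::{finite,linorder}"
  assumes n: "\<And>j. 1 \<le> n $ j" and \<gamma>: "\<gamma> \<in> spectral_set n"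
  shows "interp n (\<lambda>i. cheb \<gamma> (node n i)) = cheb \<gamma>"
proof (rule ext)
  fix x
  have box: "i \<in> box_set n" if "i \<in> index_set n" for i using that index_set_subset_box by blast
  have "interp n (\<lambda>i. cheb \<gamma> (node n i)) x = (\<Sum>i\<in>index_set n. \<Sum>\<delta>\<in>spectral_set n.
      of_real (weight n i * (grid_cheb n \<gamma> i * grid_cheb n \<delta> i)) * (cheb \<delta> x / of_real (disc_norm n \<delta>)))"
    unfolding interp_def sum_fun_apply
    by (intro sum.cong refl) (simp add: cfun_scale_def lagrange_eq[OF n box] cheb_node[OF n box]
      sum_fun_apply sum_distrib_left mult_ac)
  also have "\<dots> = (\<Sum>\<delta>\<in>spectral_set n.
      of_real (\<Sum>i\<in>index_set n. weight n i * (grid_cheb n \<gamma> i * grid_cheb n \<delta> i)) * (cheb \<delta> x / of_real (disc_norm n \<delta>)))"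
    by (subst sum.swap) (simp only: sum_distrib_right of_real_sum)
  also have "\<dots> = (\<Sum>\<delta>\<in>spectral_set n. if \<delta> = \<gamma> then cheb \<gamma> x else 0)"
    using disc_norm_pos[of n] by (intro sum.cong) (auto simp: disc_inner[OF n \<gamma>] less_imp_neq[symmetric])
  also have "\<dots> = cheb \<gamma> x"
    using \<gamma> finite_spectral_set[of n] by simp
  finally show "interp n (\<lambda>i. cheb \<gamma> (node n i)) x = cheb \<gamma> x" .
qed

text \<open>Both sides are linear in \<open>P\<close>, so the generators suffice. Uniqueness and the
  spanning statements rest on this recovery of \<open>P\<close> from its node values.\<close>

lemma interp_poly_space:
  fixes n :: "nat ^ 'd::{finite,linorder}"
  assumes n: "\<And>j. 1 \<le> n $ j" and "P \<in> poly_space n"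
  shows "interp n (\<lambda>i. P (node n i)) = P"
proof -
  have "P \<in> cfun.span (cheb ` spectral_set n)" using assms by (simp add: poly_space_def)
  then show ?thesis
  proof (induction rule: cfun.span_induct)
    case base
    show ?case
      by (rule cfun.subspaceI)
        (auto simp: interp_def cfun_scale_def fun_eq_iff sum_fun_apply sum.distrib distrib_right
          mult.assoc sum_distrib_left[symmetric])
  next
    case (step P)
    then show ?case using interp_cheb[OF n] by auto
  qed
qed

lemma interp_in_span_lagrange: "interp n h \<in> cfun.span (lagrange n ` index_set n)"
  unfolding interp_def by (intro cfun.span_sum cfun.span_scale cfun.span_base) auto

theorem theorem2p8:
  fixes n :: "nat ^ 'd::{finite,linorder}"
  assumes "\<And>j. 1 \<le> n $ j"
    and "\<And>i j. i \<noteq> j \<Longrightarrow> coprime (n $ i) (n $ j)"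
  shows "(\<forall>h\<in>data_space n.
            interp n h \<in> poly_space n \<and> solves n h (interp n h) \<and>
            (\<forall>P\<in>poly_space n. solves n h P \<longrightarrow> P = interp n h)) \<and>
         cfun.span {interp n h | h. h \<in> data_space n} = poly_space n \<and>
         (inj_on (lagrange n) (index_set n) \<and>
          cfun.independent (lagrange n ` index_set n) \<and>
          cfun.span (lagrange n ` index_set n) = poly_space n)"
proof (intro conjI ballI impI)
  have node: "interp n h (node n k) = h k" if "k \<in> index_set n" for h k
    by (rule interp_node[OF assms that])
  have delta: "lagrange n i (node n k) = of_bool (i = k)" if "i \<in> index_set n" "k \<in> index_set n" for i k
    by (rule lagrange_node[OF assms that])
  have poly_sub: "S \<subseteq> poly_space n \<Longrightarrow> cfun.span S \<subseteq> poly_space n" for S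
    unfolding poly_space_def by (rule cfun.span_minimal) auto
  have interp_cong: "interp n h = interp n h'" if "\<And>i. i \<in> index_set n \<Longrightarrow> h i = h' i" for h h'
    unfolding interp_def using that by (intro sum.cong) auto
  show "interp n h \<in> poly_space n" for h by (rule interp_in_poly_space[OF assms(1)])
  show "solves n h (interp n h)" for h using node by (simp add: solves_def)
  show "P = interp n h" if "P \<in> poly_space n" "solves n h P" for P h
    using interp_poly_space[OF assms(1) that(1)] interp_cong[of "\<lambda>i. P (node n i)" h] that(2)
    by (simp add: solves_def)
  show "cfun.span {interp n h | h. h \<in> data_space n} = poly_space n"
  proof
    show "cfun.span {interp n h | h. h \<in> data_space n} \<subseteq> poly_space n"
      using interp_in_poly_space[OF assms(1)] by (intro poly_sub) auto
    show "poly_space n \<subseteq> cfun.span {interp n h | h. h \<in> data_space n}"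
    proof
      fix P assume P: "P \<in> poly_space n"
      \<comment> \<open>Restriction makes the data extensional, as \<open>data_space\<close>
        requires; \<open>interp\<close> sees only the values on the index set.\<close>
      define h where "h = restrict (\<lambda>i. P (node n i)) (index_set n)"
      have "interp n h = P"
        using interp_poly_space[OF assms(1) P] interp_cong[of h "\<lambda>i. P (node n i)"] by (simp add: h_def)
      moreover have "h \<in> data_space n" by (simp add: h_def data_space_def)
      ultimately show "P \<in> cfun.span {interp n h | h. h \<in> data_space n}"
        by (intro cfun.span_base) auto
    qed
  qed
  show inj: "inj_on (lagrange n) (index_set n)"
  proof (rule inj_onI)
    fix i k assume "i \<in> index_set n" "k \<in> index_set n" "lagrange n i = lagrange n k"
    then show "i = k" using delta[of i k] delta[of k k] by (auto split: if_splits)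
  qed
  show "cfun.span (lagrange n ` index_set n) = poly_space n"
  proof
    show "cfun.span (lagrange n ` index_set n) \<subseteq> poly_space n"
      using lagrange_in_poly_space[OF assms(1)] index_set_subset_box by (intro poly_sub) auto
    show "poly_space n \<subseteq> cfun.span (lagrange n ` index_set n)"
      using interp_poly_space[OF assms(1)] interp_in_span_lagrange[of n] by (metis subsetI)
  qed
  show "cfun.independent (lagrange n ` index_set n)"
  proof (rule cfun.independent_if_scalars_zero)
    show "finite (lagrange n ` index_set n)" by (simp add: finite_index_set)
    fix c P assume sum: "(\<Sum>P\<in>lagrange n ` index_set n. cfun_scale (c P) P) = 0"
      and "P \<in> lagrange n ` index_set n"
    then obtain k where k: "k \<in> index_set n" "P = lagrange n k" by auto
    \<comment> \<open>By injectivity the linear relation is an interpolant with the coefficients as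
      data; its value at the node of \<open>k\<close> is the coefficient of
      \<open>P\<close>.\<close>
    have "interp n (\<lambda>i. c (lagrange n i)) = 0"
      using sum by (simp add: interp_def sum.reindex[OF inj])
    then show "c P = 0" using node[OF k(1), of "\<lambda>i. c (lagrange n i)"] k(2) by simp
  qed
qed

end
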